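(* Let $U\subseteq\mathbb{C}$ be a hyperbolic domain and let $\varphi:U\to U$ be holomorphic. If the composition operator $C_\varphi:H(U)\to H(U)$, $f\mapsto f\circ\varphi$, is weakly supercyclic, then $\varphi$ is injective and strongly runaway.
   Context: A domain $U\subseteq\mathbb{C}$ is hyperbolic if its universal covering surface is conformally isomorphic to the open unit disc. $H(U)$ is the space of holomorphic functions on $U$ with the compact-open topology. $\varphi$ is strongly runaway if for each compact $K\subset U$ there is $n_0$ such that $\varphi^n(K)\cap K=\emptyset$ for each $n\ge n_0$, where $\varphi^n$ is the $n$-th iterate. $C_\varphi$ is weakly supercyclic if there is $f\in H(U)$ such that $\{\lambda C_\varphi^n f:\lambda\in\mathbb{C},\ n=0,1,2,\dots\}$ is dense in $H(U)$ for the weak topology. *)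

theory Defs
  imports "HOL-Complex_Analysis.Complex_Analysis"
begin

definition domain :: "complex set \<Rightarrow> bool" where
  "domain U \<longleftrightarrow> open U \<and> connected U \<and> U \<noteq> {}"

(* The universal covering surface of U is conformally isomorphic to the open unit disc,
   i.e. the disc itself (being simply connected) is the total space of a holomorphic
   covering of U. *)
definition hyperbolic_domain :: "complex set \<Rightarrow> bool" where
  "hyperbolic_domain U \<longleftrightarrow> domain U \<and>
     (\<exists>p. p holomorphic_on ball 0 1 \<and> covering_space (ball (0::complex) 1) p U)"

(* A holomorphic function on U is represented by its extension by 0 to all of the complex
   plane, so that equality in H U is equality on U and H U is closed under the pointwise
   vector space operations. *)
definition H :: "complex set \<Rightarrow> (complex \<Rightarrow> complex) set" where
  "H U = {f. f holomorphic_on U \<and> (\<forall>z. z \<notin> U \<longrightarrow> f z = 0)}"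

definition compact_open :: "complex set \<Rightarrow> (complex \<Rightarrow> complex) topology" where
  "compact_open U =
     topology_generated_by {{f \<in> H U. f ` K \<subseteq> V} | K V. compact K \<and> K \<subseteq> U \<and> open V}"

definition linear_functional_on_H :: "complex set \<Rightarrow> ((complex \<Rightarrow> complex) \<Rightarrow> complex) \<Rightarrow> bool" where
  "linear_functional_on_H U L \<longleftrightarrow>
     (\<forall>f\<in>H U. \<forall>g\<in>H U. L (\<lambda>z. f z + g z) = L f + L g) \<and>
     (\<forall>c. \<forall>f\<in>H U. L (\<lambda>z. c * f z) = c * L f)"

definition dual_H :: "complex set \<Rightarrow> ((complex \<Rightarrow> complex) \<Rightarrow> complex) set" where
  "dual_H U = {L. linear_functional_on_H U L \<and> continuous_map (compact_open U) euclidean L}"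

definition weak_topology :: "complex set \<Rightarrow> (complex \<Rightarrow> complex) topology" where
  "weak_topology U =
     topology_generated_by {{f \<in> H U. L f \<in> V} | L V. L \<in> dual_H U \<and> open V}"

definition comp_op ::
    "complex set \<Rightarrow> (complex \<Rightarrow> complex) \<Rightarrow> (complex \<Rightarrow> complex) \<Rightarrow> (complex \<Rightarrow> complex)" where
  "comp_op U \<phi> f = (\<lambda>z. if z \<in> U then f (\<phi> z) else 0)"

definition weakly_supercyclic ::
    "complex set \<Rightarrow> ((complex \<Rightarrow> complex) \<Rightarrow> (complex \<Rightarrow> complex)) \<Rightarrow> bool" where
  "weakly_supercyclic U T \<longleftrightarrow>
     (\<exists>f\<in>H U. weak_topology U closure_of {(\<lambda>z. c * (T ^^ n) f z) | c n. True} = H U)"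

definition strongly_runaway :: "complex set \<Rightarrow> (complex \<Rightarrow> complex) \<Rightarrow> bool" where
  "strongly_runaway U \<phi> \<longleftrightarrow>
     (\<forall>K. compact K \<and> K \<subseteq> U \<longrightarrow> (\<exists>n0. \<forall>n\<ge>n0. (\<phi> ^^ n) ` K \<inter> K = {}))"

lemma comp_op_in_H:
  assumes "\<phi> holomorphic_on U" "\<phi> ` U \<subseteq> U" "f \<in> H U"
  shows "comp_op U \<phi> f \<in> H U"
proof -
  have "(f \<circ> \<phi>) holomorphic_on U"
    using assms holomorphic_on_compose_gen[of \<phi> U f U] by (auto simp: H_def)
  then have "comp_op U \<phi> f holomorphic_on U"
    by (rule holomorphic_transform) (simp add: comp_op_def)
  then show ?thesis by (simp add: H_def comp_op_def)
qed

lemma topspace_compact_open: "topspace (compact_open U) = H U"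
proof -
  have "H U \<in> {{f \<in> H U. f ` K \<subseteq> V} | K V. compact K \<and> K \<subseteq> U \<and> open V}"
    by (intro CollectI exI[of _ "{}"] exI[of _ UNIV]) simp
  then show ?thesis
    unfolding compact_open_def topology_generated_by_topspace by blast
qed

lemma topspace_weak_topology: "topspace (weak_topology U) = H U"
proof -
  have "(\<lambda>_. 0) \<in> dual_H U"
    by (auto simp: dual_H_def linear_functional_on_H_def)
  then have "H U \<in> {{f \<in> H U. L f \<in> V} | L V. L \<in> dual_H U \<and> open V}"
    by (intro CollectI exI[of _ "\<lambda>_. 0"] exI[of _ UNIV]) auto
  then show ?thesis
    unfolding weak_topology_def topology_generated_by_topspace by blast
qed

end

(* Suppose phi is not strongly runaway. It does not increase the pseudometric d on U obtained by
   pushing the Poincare distance of the disc down along the covering, and bounded sets for d are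
   relatively compact. By Calka's theorem an orbit returning infinitely often to a compact set is
   bounded, so every orbit of phi is relatively compact in U. Averaging along the orbit of a point
   gives a continuous linear functional L with L(g o phi) = L(g) and L(1) = 1. Choose a point w of U
   such that L and evaluation at w differ. On the multiples c f o phi^n of a given f, L takes the
   value c L(f), whereas evaluation at w is bounded by |c| times the supremum of |f| on the orbit
   of w; so the pair of functionals cannot map these multiples to a dense subset of the plane C^2.

   If phi identifies a and b, then all multiples with n > 0 lie in the hyperplane g(a) = g(b), and
   those with n = 0 lie in a second hyperplane, so they are not weakly dense either. *)
theory Submission
  imports Defs
begin

section \<open>Bounded orbits of nonexpansive maps\<close>

text \<open>An abstract stand-in for the hyperbolic distance. Compactness and neighbourhoods refer
  to the original metric of \<open>X\<close>, linked to \<open>d\<close> by the last two axioms.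
  Distinct points may have \<open>d\<close>-distance 0, so the infimum defining
  \<open>dist_U\<close> need not be shown to separate points.\<close>

locale proper_pseudometric =
  fixes X :: "'a::metric_space set" and d :: "'a \<Rightarrow> 'a \<Rightarrow> real"
  assumes nonneg: "\<lbrakk>x \<in> X; y \<in> X\<rbrakk> \<Longrightarrow> 0 \<le> d x y"
    and commute: "\<lbrakk>x \<in> X; y \<in> X\<rbrakk> \<Longrightarrow> d x y = d y x"
    and triangle: "\<lbrakk>x \<in> X; y \<in> X; z \<in> X\<rbrakk> \<Longrightarrow> d x z \<le> d x y + d y z"
    and small_nhd: "\<lbrakk>x \<in> X; 0 < e\<rbrakk> \<Longrightarrow> \<exists>N. open N \<and> x \<in> N \<and> (\<forall>y\<in>N \<inter> X. d x y < e)"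
    and proper: "x \<in> X \<Longrightarrow> \<exists>K. compact K \<and> K \<subseteq> X \<and> {y \<in> X. d x y \<le> M} \<subseteq> K"
begin

lemma compact_finite_cover:
  assumes "compact K" "K \<subseteq> X" "0 < e"
  obtains F where "finite F" "F \<subseteq> K" "\<And>y. y \<in> K \<Longrightarrow> \<exists>t\<in>F. d t y < e"
proof -
  obtain N where N: "\<And>x. x \<in> K \<Longrightarrow> open (N x) \<and> x \<in> N x \<and> (\<forall>y\<in>N x \<inter> X. d x y < e)"
    using small_nhd[OF _ assms(3)] assms(2) by (metis subsetD)
  obtain F where F: "F \<subseteq> K" "finite F" "K \<subseteq> (\<Union>x\<in>F. N x)"
    using compactE_image[OF assms(1), of K N] N by blast
  show thesis
  proof (rule that[of F])
    fix y assume y: "y \<in> K"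
    then obtain t where t: "t \<in> F" "y \<in> N t" using F by auto
    then show "\<exists>t\<in>F. d t y < e" using N[of t] F(1) y assms(2) by blast
  qed (use F in auto)
qed

lemma compact_bounded:
  assumes "compact K" "K \<subseteq> X" "x \<in> X"
  obtains B where "\<And>y. y \<in> K \<Longrightarrow> d x y \<le> B"
proof -
  obtain F where F: "finite F" "F \<subseteq> K" "\<And>y. y \<in> K \<Longrightarrow> \<exists>t\<in>F. d t y < 1"
    using compact_finite_cover[OF assms(1,2), of 1] by auto
  show thesis
  proof (rule that)
    fix y assume y: "y \<in> K"
    then obtain t where t: "t \<in> F" "d t y < 1" using F by auto
    have "d x t \<le> Max (d x ` F)" using F t by simp
    moreover have "d x y \<le> d x t + d t y"
      using triangle assms F t y by (meson subsetD)
    ultimately show "d x y \<le> Max (d x ` F) + 1" using t by linarith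
  qed
qed

text \<open>Properness puts \<open>S\<close> inside a compact set, which has a finite
  \<open>e / 2\<close>-net; moving each useful centre to a nearby point of \<open>S\<close> costs
  another \<open>e / 2\<close>.\<close>

lemma bounded_finite_net:
  assumes "S \<subseteq> X" "x \<in> X" "\<And>y. y \<in> S \<Longrightarrow> d x y \<le> M" "0 < e"
  obtains F where "finite F" "F \<subseteq> S" "\<And>y. y \<in> S \<Longrightarrow> \<exists>t\<in>F. d y t < e"
proof -
  obtain K where K: "compact K" "K \<subseteq> X" "{y \<in> X. d x y \<le> M} \<subseteq> K"
    using proper[OF assms(2)] by blast
  obtain G where G: "finite G" "G \<subseteq> K" "\<And>y. y \<in> K \<Longrightarrow> \<exists>t\<in>G. d t y < e / 2"
    using compact_finite_cover[OF K(1,2), of "e / 2"] assms(4) by auto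
  define c where "c t = (SOME y. y \<in> S \<and> d t y < e / 2)" for t
  define F where "F = c ` {t \<in> G. \<exists>y\<in>S. d t y < e / 2}"
  have c: "c t \<in> S \<and> d t (c t) < e / 2" if "y \<in> S" "d t y < e / 2" for t y
    unfolding c_def by (rule someI[of _ y]) (use that in auto)
  show thesis
  proof (rule that[of F])
    show "F \<subseteq> S" using c by (auto simp: F_def)
    fix y assume y: "y \<in> S"
    then have "y \<in> K" using K(3) assms by blast
    then obtain t where t: "t \<in> G" "d t y < e / 2" using G by auto
    have X: "t \<in> X" "y \<in> X" "c t \<in> X" using t G K y c[OF y t(2)] assms by auto
    have "d y (c t) \<le> d y t + d t (c t)" using triangle X by blast
    also have "\<dots> < e" using c[OF y t(2)] t(2) commute X by force
    finally show "\<exists>t\<in>F. d y t < e" using t y by (auto simp: F_def)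
  qed (use G in \<open>simp add: F_def\<close>)
qed

end

lemma funpow_add_apply: "(f ^^ m) ((f ^^ n) x) = (f ^^ (m + n)) x"
  by (simp add: funpow_add)

locale nonexpansive_map = proper_pseudometric X d
  for X :: "'a::metric_space set" and d +
  fixes f :: "'a \<Rightarrow> 'a"
  assumes maps: "x \<in> X \<Longrightarrow> f x \<in> X"
    and nonexpansive: "\<lbrakk>x \<in> X; y \<in> X\<rbrakk> \<Longrightarrow> d (f x) (f y) \<le> d x y"
begin

lemma iterate_in: "x \<in> X \<Longrightarrow> (f ^^ n) x \<in> X"
  by (induction n) (auto intro: maps)

lemma iterate_nonexpansive: "\<lbrakk>x \<in> X; y \<in> X\<rbrakk> \<Longrightarrow> d ((f ^^ n) x) ((f ^^ n) y) \<le> d x y"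
  by (induction n) (auto intro: order_trans nonexpansive iterate_in)

text \<open>Shifting a pair of orbit points further along the orbit never increases their distance,
  but at a late return time \<open>m\<close> the shifted pair is almost the original one. So nothing
  can have been lost at the intermediate time \<open>n\<close>.\<close>

lemma recurrent_orbit_isometric:
  assumes y: "y \<in> X" and rec: "\<And>e N. 0 < e \<Longrightarrow> \<exists>m\<ge>N. d ((f ^^ m) y) y < e"
  shows "d ((f ^^ i) y) y \<le> d ((f ^^ (i + n)) y) ((f ^^ n) y)"
proof (rule field_le_epsilon)
  fix e :: real assume "0 < e"
  then obtain m where m: "m \<ge> n" "d ((f ^^ m) y) y < e / 2" using rec[of "e / 2" n] by auto
  note [simp] = y iterate_in
  have "d ((f ^^ i) y) ((f ^^ i) ((f ^^ m) y)) \<le> d y ((f ^^ m) y)"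
    by (rule iterate_nonexpansive) simp_all
  then have 1: "d ((f ^^ i) y) ((f ^^ (i + m)) y) < e / 2"
    using m commute[of y "(f ^^ m) y"] by (simp add: funpow_add_apply)
  have "d ((f ^^ (m - n)) ((f ^^ (i + n)) y)) ((f ^^ (m - n)) ((f ^^ n) y))
      \<le> d ((f ^^ (i + n)) y) ((f ^^ n) y)"
    by (rule iterate_nonexpansive) simp_all
  then have 2: "d ((f ^^ (i + m)) y) ((f ^^ m) y) \<le> d ((f ^^ (i + n)) y) ((f ^^ n) y)"
    using m(1) by (simp add: funpow_add_apply add.commute)
  have "d ((f ^^ i) y) y \<le> d ((f ^^ i) y) ((f ^^ (i + m)) y) + d ((f ^^ (i + m)) y) y"
       "d ((f ^^ (i + m)) y) y \<le> d ((f ^^ (i + m)) y) ((f ^^ m) y) + d ((f ^^ m) y) y"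
    by (auto intro!: triangle)
  with 1 2 m(2) show "d ((f ^^ i) y) y \<le> d ((f ^^ (i + n)) y) ((f ^^ n) y) + e" by linarith
qed

text \<open>Visits to the unit ball around \<open>y\<close> happen with gaps at most some fixed
  \<open>m\<close>; the subadditivity of \<open>a\<close> controls the orbit between two
  visits.\<close>

lemma recurrent_orbit_bounded:
  assumes y: "y \<in> X" and rec: "\<And>e N. 0 < e \<Longrightarrow> \<exists>m\<ge>N. d ((f ^^ m) y) y < e"
  obtains M where "\<And>n. d ((f ^^ n) y) y \<le> M"
proof -
  note [simp] = y iterate_in
  define a where "a n = d ((f ^^ n) y) y" for n
  define R where "R = {n. a n < 1}"
  have tri: "a (i + j) \<le> a i + a j" for i j
  proof -
    have "d ((f ^^ (i + j)) y) y \<le> d ((f ^^ (i + j)) y) ((f ^^ i) y) + d ((f ^^ i) y) y"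
      by (auto intro!: triangle)
    moreover have "d ((f ^^ i) ((f ^^ j) y)) ((f ^^ i) y) \<le> d ((f ^^ j) y) y"
      by (rule iterate_nonexpansive) simp_all
    ultimately show ?thesis by (simp add: a_def funpow_add_apply)
  qed
  \<comment> \<open>A finite \<open>1 / 2\<close>-net of the visits, consisting of visits at the
    times \<open>J\<close>.\<close>
  obtain F where F: "finite F" "F \<subseteq> (\<lambda>n. (f ^^ n) y) ` R"
      "\<And>x. x \<in> (\<lambda>n. (f ^^ n) y) ` R \<Longrightarrow> \<exists>t\<in>F. d x t < 1 / 2"
  proof (rule bounded_finite_net[of "(\<lambda>n. (f ^^ n) y) ` R" y 1 "1 / 2"])
    fix x assume "x \<in> (\<lambda>n. (f ^^ n) y) ` R"
    then obtain n where "a n < 1" "x = (f ^^ n) y" by (auto simp: R_def)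
    then show "d y x \<le> 1" using commute[of y x] by (simp add: a_def)
  qed (auto)
  then obtain J where J: "finite J" "J \<subseteq> R" "F = (\<lambda>n. (f ^^ n) y) ` J"
    using finite_subset_image by metis
  \<comment> \<open>A close return later than every time in \<open>J\<close>, so that the shifts
    \<open>m - j\<close> below are positive.\<close>
  obtain m where m: "m \<ge> Suc (Max (insert 0 J))" "a m < 1 / 2"
    unfolding a_def using rec[of "1 / 2" "Suc (Max (insert 0 J))"] by auto
  have Jm: "j < m" if "j \<in> J" for j
  proof -
    have "j \<le> Max (insert 0 J)" using that J(1) by simp
    then show ?thesis using m(1) by simp
  qed
  have next_return: "\<exists>i. 0 < i \<and> i \<le> m \<and> n + i \<in> R" if n: "n \<in> R" for n
  proof -
    obtain j where j: "j \<in> J" "d ((f ^^ n) y) ((f ^^ j) y) < 1 / 2" using F(3) n J(3) by auto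
    \<comment> \<open>The next visit is at time \<open>n + (m - j)\<close>: moving the pair on by
      \<open>j\<close> steps compares times \<open>n + m\<close> and \<open>j\<close>, and the
      detour through time \<open>n\<close> costs less than \<open>1 / 2\<close> on each leg.\<close>
    have "a (n + (m - j)) \<le> d ((f ^^ (n + (m - j) + j)) y) ((f ^^ j) y)"
      unfolding a_def by (rule recurrent_orbit_isometric[OF y rec])
    also have "\<dots> = d ((f ^^ (n + m)) y) ((f ^^ j) y)" using Jm[OF j(1)] by simp
    also have "\<dots> \<le> d ((f ^^ (n + m)) y) ((f ^^ n) y) + d ((f ^^ n) y) ((f ^^ j) y)"
      by (auto intro!: triangle)
    also have "d ((f ^^ (n + m)) y) ((f ^^ n) y) \<le> a m"
      using iterate_nonexpansive[of "(f ^^ m) y" y n] by (simp add: funpow_add_apply a_def)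
    finally have "n + (m - j) \<in> R" using j m by (simp add: R_def)
    then show ?thesis using Jm[OF j(1)] by (intro exI[of _ "m - j"]) auto
  qed
  have "a 0 < 1"
  proof -
    obtain N where "y \<in> N" "\<forall>z\<in>N \<inter> X. d y z < 1" using small_nhd[of y 1] by auto
    then show ?thesis using y by (simp add: a_def)
  qed
  have prev_return: "\<exists>r\<in>R. r \<le> n \<and> n \<le> r + m" for n
  proof (induction n)
    case 0
    then show ?case using \<open>a 0 < 1\<close> by (auto simp: R_def)
  next
    case (Suc n)
    then obtain r where r: "r \<in> R" "r \<le> n" "n \<le> r + m" by auto
    obtain i where i: "0 < i" "i \<le> m" "r + i \<in> R" using next_return[OF r(1)] by auto
    show ?case
    proof (cases "Suc n \<le> r + m")
      case True
      then show ?thesis using r by (intro bexI[of _ r]) auto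
    next
      case False
      then show ?thesis using r i by (intro bexI[of _ "r + i"]) auto
    qed
  qed
  show thesis
  proof (rule that)
    fix n
    obtain r where r: "r \<in> R" "r \<le> n" "n \<le> r + m" using prev_return by blast
    have "a (n - r) \<le> Max (a ` {..m})" using r by (intro Max_ge) auto
    moreover have "a n \<le> a r + a (n - r)" using tri[of r "n - r"] r by simp
    ultimately show "d ((f ^^ n) y) y \<le> 1 + Max (a ` {..m})"
      using r(1) by (simp add: R_def a_def[symmetric])
  qed
qed

text \<open>Calka's theorem: an orbit returning infinitely often to a bounded set is bounded. A limit
  point of the returns is recurrent, and by total boundedness of the unit ball the gaps between
  consecutive returns of a recurrent point to it are bounded.\<close>

lemma frequent_return_orbits_bounded:
  assumes K: "compact K" "K \<subseteq> X" and ret: "\<And>n0. \<exists>n\<ge>n0. (f ^^ n) ` K \<inter> K \<noteq> {}"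
    and x: "x \<in> X"
  obtains C where "compact C" "C \<subseteq> X" "\<And>n. (f ^^ n) x \<in> C"
proof -
  obtain x0 where x0: "x0 \<in> K" using ret[of 0] by auto
  then have [simp]: "x0 \<in> X" using K by auto
  note [simp] = iterate_in
  obtain B where B: "\<And>y. y \<in> K \<Longrightarrow> d x0 y \<le> B" using compact_bounded[OF K, of x0] by auto
  \<comment> \<open>If \<open>z\<close> and its \<open>n\<close>-th iterate both lie in
    \<open>K\<close>, each contributes at most \<open>B\<close>, so the \<open>n\<close>-th iterate
    of \<open>x0\<close> is within \<open>2 * B\<close> of \<open>x0\<close>.\<close>
  obtain C where C: "compact C" "C \<subseteq> X" "{y \<in> X. d x0 y \<le> 2 * B} \<subseteq> C"
    using proper[of x0 "2 * B"] by auto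
  define I where "I = {n. (f ^^ n) x0 \<in> C}"
  have "\<exists>n\<ge>n0. n \<in> I" for n0
  proof -
    obtain n z where n: "n \<ge> n0" "z \<in> K" "(f ^^ n) z \<in> K" using ret[of n0] by auto
    have zX: "z \<in> X" using n K by auto
    have "d x0 ((f ^^ n) x0) \<le> d x0 ((f ^^ n) z) + d ((f ^^ n) z) ((f ^^ n) x0)"
      using zX by (intro triangle) auto
    moreover have "d ((f ^^ n) z) ((f ^^ n) x0) \<le> d z x0" using zX by (intro iterate_nonexpansive) auto
    moreover have "d z x0 = d x0 z" using zX by (intro commute) auto
    ultimately have "d x0 ((f ^^ n) x0) \<le> 2 * B" using B[OF n(2)] B[OF n(3)] by linarith
    then have "(f ^^ n) x0 \<in> C" using C(3) by auto
    then show ?thesis using n(1) by (auto simp: I_def)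
  qed
  then have "infinite I" unfolding infinite_nat_iff_unbounded_le by auto
  define r where "r = enumerate I"
  have r: "strict_mono r" "\<And>k. r k \<in> I"
    using \<open>infinite I\<close> by (auto simp: r_def strict_mono_enumerate enumerate_in_set)
  have "\<forall>k. (f ^^ r k) x0 \<in> C" using r(2) by (simp add: I_def)
  then obtain y s where y: "y \<in> C" "strict_mono s" "((\<lambda>k. (f ^^ r k) x0) \<circ> s) \<longlonglongrightarrow> y"
    using C(1) unfolding compact_def by metis
  define q where "q = r \<circ> s"
  have q: "strict_mono q" "(\<lambda>k. (f ^^ q k) x0) \<longlonglongrightarrow> y"
    using r y strict_mono_o[of r s] by (auto simp: q_def o_def)
  have yX [simp]: "y \<in> X" using y C by auto
  have "\<exists>m\<ge>N. d ((f ^^ m) y) y < e" if e: "0 < e" for e N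
  proof -
    obtain T where T: "open T" "y \<in> T" "\<forall>z\<in>T \<inter> X. d y z < e / 2"
      using small_nhd[OF yX half_gt_zero[OF e]] by blast
    obtain k where k: "\<And>j. j \<ge> k \<Longrightarrow> (f ^^ q j) x0 \<in> T"
      using topological_tendstoD[OF q(2) T(1,2)] by (auto simp: eventually_sequentially)
    have close: "d y ((f ^^ q j) x0) < e / 2" if "j \<ge> k" for j using T k[OF that] by simp
    have gap: "q k + N \<le> q (k + N)"
    proof (induction N)
      case (Suc N)
      then show ?case using strict_monoD[OF q(1), of "k + N" "k + Suc N"] by simp
    qed simp
    \<comment> \<open>Differences of late return times are the recurrence times of \<open>y\<close>:
      \<open>m\<close> steps carry the point at time \<open>q k\<close>, which is near
      \<open>y\<close>, to the point at time \<open>q (k + N)\<close>, again near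
      \<open>y\<close>.\<close>
    define m where "m = q (k + N) - q k"
    have "d ((f ^^ m) y) ((f ^^ m) ((f ^^ q k) x0)) \<le> d y ((f ^^ q k) x0)"
      by (intro iterate_nonexpansive) auto
    then have "d ((f ^^ m) y) ((f ^^ q (k + N)) x0) \<le> d y ((f ^^ q k) x0)"
      using gap by (simp add: m_def funpow_add_apply)
    moreover have "d ((f ^^ m) y) y \<le> d ((f ^^ m) y) ((f ^^ q (k + N)) x0) + d ((f ^^ q (k + N)) x0) y"
      by (intro triangle) auto
    moreover have "d ((f ^^ q (k + N)) x0) y = d y ((f ^^ q (k + N)) x0)" by (intro commute) auto
    ultimately have "d ((f ^^ m) y) y < e" using close[of k] close[of "k + N"] by simp
    moreover have "m \<ge> N" using gap by (simp add: m_def)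
    ultimately show ?thesis by blast
  qed
  then obtain M where M: "\<And>n. d ((f ^^ n) y) y \<le> M" using recurrent_orbit_bounded[OF yX] by metis
  \<comment> \<open>The orbit of \<open>x\<close> stays within \<open>d x y\<close> of the bounded
    orbit of \<open>y\<close>.\<close>
  obtain C' where C': "compact C'" "C' \<subseteq> X" "{z \<in> X. d y z \<le> M + d x y} \<subseteq> C'"
    using proper[of y "M + d x y"] by auto
  show thesis
  proof (rule that[OF C'(1,2)])
    fix n
    have "d y ((f ^^ n) x) = d ((f ^^ n) x) y" using x by (intro commute) auto
    moreover have "d ((f ^^ n) x) y \<le> d ((f ^^ n) x) ((f ^^ n) y) + d ((f ^^ n) y) y"
      using x by (intro triangle) auto
    moreover have "d ((f ^^ n) x) ((f ^^ n) y) \<le> d x y" using x by (intro iterate_nonexpansive) auto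
    ultimately have "d y ((f ^^ n) x) \<le> M + d x y" using M[of n] by linarith
    then show "(f ^^ n) x \<in> C'" using C'(3) x by auto
  qed
qed

end

section \<open>The Poincare distance of the disc\<close>

text \<open>The Poincare distance normalised to curvature -4: \<open>artanh\<close> of the
  pseudohyperbolic distance.\<close>

definition disc_dist :: "complex \<Rightarrow> complex \<Rightarrow> real" where
  "disc_dist a b = artanh (norm (Moebius_function 0 a b))"

lemma artanh_mono_real:
  fixes x y :: real
  assumes "-1 < x" "x \<le> y" "y < 1"
  shows "artanh x \<le> artanh y"
proof -
  have "(1 + x) / (1 - x) \<le> (1 + y) / (1 - y)" using assms by (simp add: field_simps)
  then show ?thesis using assms by (simp add: artanh_def)
qed

text \<open>The addition law that turns the bound of \<open>Moebius_norm_le\<close> into a sum of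
  distances.\<close>

lemma artanh_add_real:
  fixes x y :: real
  assumes "0 \<le> x" "x < 1" "0 \<le> y" "y < 1"
  shows "artanh x + artanh y = artanh ((x + y) / (1 + x * y))"
proof -
  have p: "1 + x * y > 0" using assms by (simp add: add_pos_nonneg)
  have "1 + (x + y) / (1 + x * y) = ((1 + x * y) + (x + y)) / (1 + x * y)"
       "1 - (x + y) / (1 + x * y) = ((1 + x * y) - (x + y)) / (1 + x * y)"
    using p by (simp_all add: add_divide_distrib diff_divide_distrib)
  then have "(1 + (x + y) / (1 + x * y)) / (1 - (x + y) / (1 + x * y))
      = ((1 + x * y) + (x + y)) / ((1 + x * y) - (x + y))"
    using p by simp
  also have "\<dots> = (1 + x) / (1 - x) * ((1 + y) / (1 - y))"
    by (simp add: algebra_simps)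
  finally have "artanh ((x + y) / (1 + x * y)) = ln ((1 + x) / (1 - x) * ((1 + y) / (1 - y))) / 2"
    by (simp only: artanh_def)
  also have "ln ((1 + x) / (1 - x) * ((1 + y) / (1 - y))) = ln ((1 + x) / (1 - x)) + ln ((1 + y) / (1 - y))"
    using assms by (intro ln_mult_pos) simp_all
  also have "(ln ((1 + x) / (1 - x)) + ln ((1 + y) / (1 - y))) / 2 = artanh x + artanh y"
    unfolding artanh_def by (rule add_divide_distrib)
  finally show ?thesis by simp
qed

text \<open>One minus the squared norm of the Moebius quotient equals
  \<open>(1 - r^2) * (1 - s^2) / q^2\<close>, where \<open>q\<close> is the norm of its denominator.
  Since \<open>q\<close> is at most \<open>1 + r * s\<close>, the bound is the value for
  \<open>z\<close> and \<open>w\<close> on opposite sides of 0.\<close>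

lemma Moebius_norm_le:
  assumes "norm z < 1" "norm w < 1"
  shows "norm (Moebius_function 0 w z) \<le> (norm w + norm z) / (1 + norm w * norm z)"
proof -
  define r s where "r = norm w" and "s = norm z"
  have rs: "0 \<le> r" "r < 1" "0 \<le> s" "s < 1" using assms by (auto simp: r_def s_def)
  define q where "q = norm (1 - cnj w * z)"
  have "norm (cnj w * z) < 1" using rs mult_strict_mono[of r 1 s 1] by (simp add: norm_mult r_def s_def)
  then have "1 - cnj w * z \<noteq> 0" by auto
  then have q0: "q > 0" by (simp add: q_def)
  have q1: "q \<le> 1 + r * s"
    using norm_triangle_ineq4[of 1 "cnj w * z"] by (simp add: q_def r_def s_def norm_mult)
  have id: "(norm (z - w))\<^sup>2 = q\<^sup>2 - (1 - r\<^sup>2) * (1 - s\<^sup>2)"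
    unfolding q_def r_def s_def cmod_power2 by (simp add: power2_eq_square algebra_simps)
  have "(norm (Moebius_function 0 w z))\<^sup>2 = 1 - (1 - r\<^sup>2) * (1 - s\<^sup>2) / q\<^sup>2"
    unfolding Moebius_function_simple norm_divide power_divide q_def[symmetric] id
    using q0 by (simp add: diff_divide_distrib)
  also have "\<dots> \<le> 1 - (1 - r\<^sup>2) * (1 - s\<^sup>2) / (1 + r * s)\<^sup>2"
    using rs q0 q1 by (intro diff_left_mono divide_left_mono mult_nonneg_nonneg)
      (auto simp: power_le_one power_mono abs_square_le_1)
  also have "\<dots> = ((r + s) / (1 + r * s))\<^sup>2"
  proof -
    have "(1 + r * s)\<^sup>2 - (1 - r\<^sup>2) * (1 - s\<^sup>2) = (r + s)\<^sup>2"
      by (simp add: power2_eq_square algebra_simps)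
    moreover have "1 + r * s \<noteq> 0" using rs by (smt (verit) mult_nonneg_nonneg)
    ultimately show ?thesis by (simp add: field_simps power_divide)
  qed
  finally have "norm (Moebius_function 0 w z) \<le> (r + s) / (1 + r * s)"
    by (rule power2_le_imp_le) (use rs in simp)
  then show ?thesis by (simp add: r_def s_def)
qed

text \<open>Pre- and postcomposing \<open>g\<close> with disc automorphisms taking 0 to
  \<open>a\<close> and \<open>g a\<close> to 0 reduces the claim to the Schwarz lemma.\<close>

lemma Schwarz_Pick:
  assumes g: "g holomorphic_on ball 0 1" "g ` ball 0 1 \<subseteq> ball 0 1"
    and a: "norm a < 1" and b: "norm b < 1"
  shows "norm (Moebius_function 0 (g a) (g b)) \<le> norm (Moebius_function 0 a b)"
proof -
  let ?M = "Moebius_function 0"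
  define h where "h = ?M (g a) \<circ> g \<circ> ?M (- a)"
  have gz: "norm (g z) < 1" if "norm z < 1" for z using g(2) that by (auto simp: image_subset_iff)
  have ma: "norm (?M (- a) z) < 1" if "norm z < 1" for z
    using that a by (intro Moebius_function_norm_lt_1) auto
  have "h holomorphic_on ball 0 1"
    unfolding h_def
  proof (intro holomorphic_on_compose_gen)
    show "?M (- a) holomorphic_on ball 0 1" using a by (intro Moebius_function_holomorphic) simp
    show "?M (g a) holomorphic_on ball 0 1" using gz a by (intro Moebius_function_holomorphic)
  qed (use g ma gz in auto)
  moreover have "?M (- a) 0 = a" by (simp add: Moebius_function_of_zero)
  then have "h 0 = 0" by (simp add: h_def Moebius_function_eq_zero)
  moreover have "norm (h z) < 1" if "norm z < 1" for z
    using that by (auto simp: h_def intro!: Moebius_function_norm_lt_1 gz ma a)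
  ultimately have "norm (h (?M a b)) \<le> norm (?M a b)"
    using Moebius_function_norm_lt_1[OF a b] by (intro Schwarz_Lemma(1)) auto
  moreover have "?M (- a) (?M a b) = b" using a b by (intro Moebius_function_compose) auto
  ultimately show ?thesis by (simp add: h_def)
qed

lemma disc_dist_nonneg:
  assumes "norm a < 1" "norm b < 1" shows "0 \<le> disc_dist a b"
  using artanh_mono_real[of 0 "norm (Moebius_function 0 a b)"] Moebius_function_norm_lt_1[OF assms]
  by (simp add: disc_dist_def)

lemma disc_dist_commute: "disc_dist a b = disc_dist b a"
proof -
  have "norm (1 - cnj a * b) = norm (cnj (1 - cnj b * a))" by (simp add: mult.commute)
  then have "norm (1 - cnj a * b) = norm (1 - cnj b * a)" by (simp only: complex_mod_cnj)
  then show ?thesis by (simp add: disc_dist_def Moebius_function_simple norm_divide norm_minus_commute)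
qed

lemma disc_dist_contraction:
  assumes g: "g holomorphic_on ball 0 1" "g ` ball 0 1 \<subseteq> ball 0 1"
    and a: "norm a < 1" and b: "norm b < 1"
  shows "disc_dist (g a) (g b) \<le> disc_dist a b"
  unfolding disc_dist_def
proof (rule artanh_mono_real[OF _ Schwarz_Pick[OF assms]])
  show "-1 < norm (Moebius_function 0 (g a) (g b))" by (rule less_le_trans[OF _ norm_ge_zero]) simp
qed (rule Moebius_function_norm_lt_1[OF a b])

text \<open>An automorphism moves the middle point \<open>b\<close> to 0, where distances are
  functions of the norm alone. Of its invariance only the contraction property of the inverse
  automorphism is used.\<close>

lemma disc_dist_triangle:
  assumes a: "norm a < 1" and b: "norm b < 1" and c: "norm c < 1"
  shows "disc_dist a c \<le> disc_dist a b + disc_dist b c"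
proof -
  let ?M = "Moebius_function 0"
  define x y where "x = ?M b a" and "y = ?M b c"
  have xy: "norm x < 1" "norm y < 1" unfolding x_def y_def by (intro Moebius_function_norm_lt_1 assms)+
  have inv: "?M (- b) x = a" "?M (- b) y = c"
    using assms by (auto simp: x_def y_def intro: Moebius_function_compose)
  have "disc_dist (?M (- b) x) (?M (- b) y) \<le> disc_dist x y"
  proof (rule disc_dist_contraction[OF _ _ xy])
    show "?M (- b) holomorphic_on ball 0 1" using b by (intro Moebius_function_holomorphic) simp
    show "?M (- b) ` ball 0 1 \<subseteq> ball 0 1" using b by (auto intro!: Moebius_function_norm_lt_1)
  qed
  then have "disc_dist a c \<le> artanh (norm (?M x y))" by (simp add: inv disc_dist_def)
  also have "\<dots> \<le> artanh ((norm x + norm y) / (1 + norm x * norm y))"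
  proof (rule artanh_mono_real)
    show "-1 < norm (?M x y)" by (rule less_le_trans[OF _ norm_ge_zero]) simp
    have "0 < (1 - norm x) * (1 - norm y)" using xy by simp
    then have "norm x + norm y < 1 + norm x * norm y" by (simp add: algebra_simps)
    then show "(norm x + norm y) / (1 + norm x * norm y) < 1"
      by (smt (verit) divide_less_eq_1 mult_nonneg_nonneg norm_ge_zero)
  qed (rule Moebius_norm_le[OF xy(2,1)])
  also have "\<dots> = artanh (norm x) + artanh (norm y)" using xy by (subst artanh_add_real) auto
  also have "artanh (norm x) = disc_dist a b" using disc_dist_commute[of a b] by (simp add: disc_dist_def x_def)
  finally show ?thesis by (simp add: disc_dist_def y_def)
qed

lemma disc_dist_le_imp_norm_le:
  assumes "norm b < 1" "disc_dist 0 b \<le> M"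
  shows "norm b \<le> tanh M"
proof -
  define x where "x = norm b"
  have x: "0 \<le> x" "x < 1" "artanh x \<le> M" using assms by (auto simp: x_def disc_dist_def Moebius_function_simple)
  have "exp (2 * artanh x) = (1 + x) / (1 - x)" using x by (simp add: artanh_def)
  moreover have "exp (2 * artanh x) \<le> exp (2 * M)" using x by simp
  ultimately have "(1 + x) / (1 - x) \<le> exp (2 * M)" by simp
  then have "x * (1 + exp (2 * M)) \<le> exp (2 * M) - 1" using x by (simp add: field_simps)
  moreover have "0 < 1 + exp (2 * M)" by (simp add: add_pos_pos)
  ultimately have "x \<le> (exp (2 * M) - 1) / (1 + exp (2 * M))"
    by (simp add: pos_le_divide_eq)
  also have "\<dots> = tanh M"
  proof -
    have "exp (2 * M) = exp M * exp M" by (simp flip: exp_add)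
    moreover have "exp (- M) * exp M = 1" by (simp flip: exp_add)
    ultimately show ?thesis by (simp add: tanh_altdef field_simps add_pos_pos less_imp_neq[symmetric] exp_minus)
  qed
  finally show ?thesis by (simp add: x_def)
qed

lemma disc_dist_small_nhd:
  assumes "norm a < 1" "0 < e"
  obtains N where "open N" "a \<in> N" "N \<subseteq> ball 0 1" "\<And>b. b \<in> N \<Longrightarrow> disc_dist a b < e"
proof -
  have "continuous_on (ball 0 1) (Moebius_function 0 a)"
    using Moebius_function_holomorphic[OF assms(1)] by (rule holomorphic_on_imp_continuous_on)
  then have "isCont (\<lambda>b. norm (Moebius_function 0 a b)) a"
    using assms(1) by (auto simp: continuous_on_eq_continuous_at intro: continuous_norm)
  moreover have "isCont artanh (norm (Moebius_function 0 a a))"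
    by (auto simp: Moebius_function_eq_zero intro: isCont_artanh)
  ultimately have "isCont (disc_dist a) a"
    unfolding disc_dist_def by (rule isCont_o2)
  then have "(disc_dist a \<longlongrightarrow> disc_dist a a) (nhds a)"
    by (simp add: isCont_def tendsto_at_iff_tendsto_nhds)
  moreover have "disc_dist a a = 0" by (simp add: disc_dist_def Moebius_function_eq_zero)
  ultimately have "(disc_dist a \<longlongrightarrow> 0) (nhds a)" by simp
  then have "\<forall>\<^sub>F b in nhds a. disc_dist a b < e" using assms(2) by (rule order_tendstoD)
  then obtain S where "open S" "a \<in> S" "\<And>b. b \<in> S \<Longrightarrow> disc_dist a b < e"
    unfolding eventually_nhds by blast
  then show thesis using assms(1) by (intro that[of "S \<inter> ball 0 1"]) auto
qed

section \<open>The hyperbolic distance of a domain covered by the disc\<close>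

locale disc_covering =
  fixes p :: "complex \<Rightarrow> complex" and U :: "complex set"
  assumes openU: "open U"
    and hol: "p holomorphic_on ball 0 1"
    and cov: "covering_space (ball 0 1) p U"
begin

definition fibre :: "complex \<Rightarrow> complex set" where
  "fibre z = {a \<in> ball 0 1. p a = z}"

text \<open>The infimum runs over lifts of both points, which makes it symmetric;
  \<open>dist_U_near_from\<close> shows that one lift may be prescribed.\<close>

definition dist_U :: "complex \<Rightarrow> complex \<Rightarrow> real" where
  "dist_U z w = (INF x\<in>fibre z \<times> fibre w. disc_dist (fst x) (snd x))"

lemma p_in: "a \<in> ball 0 1 \<Longrightarrow> p a \<in> U"
  using covering_space_imp_surjective[OF cov] by blast

lemma preimage:
  assumes "z \<in> U" obtains a where "a \<in> ball 0 1" "p a = z"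
  using covering_space_imp_surjective[OF cov] assms by blast

text \<open>The disc is simply connected, so \<open>\<phi> \<circ> p\<close> lifts through
  \<open>p\<close> with a prescribed value at one point, and a continuous lift through a holomorphic
  covering is holomorphic.\<close>

lemma holomorphic_lift:
  assumes \<phi>: "\<phi> holomorphic_on U" "\<phi> ` U \<subseteq> U"
    and a: "a \<in> ball 0 1" "b \<in> ball 0 1" "p b = \<phi> (p a)"
  obtains g where "g holomorphic_on ball 0 1" "g ` ball 0 1 \<subseteq> ball 0 1" "g a = b"
    "\<And>z. z \<in> ball 0 1 \<Longrightarrow> p (g z) = \<phi> (p z)"
proof -
  let ?D = "ball (0::complex) 1"
  have hol': "(\<phi> \<circ> p) holomorphic_on ?D"
    by (rule holomorphic_on_compose_gen[OF hol \<phi>(1)]) (auto intro: p_in)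
  have im: "\<phi> \<circ> p \<in> ?D \<rightarrow> U" using \<phi>(2) p_in by fastforce
  obtain g where g: "continuous_on ?D g" "g \<in> ?D \<rightarrow> ?D" "g a = b"
      "\<And>y. y \<in> ?D \<Longrightarrow> p (g y) = (\<phi> \<circ> p) y"
  proof (rule covering_space_lift_strong[OF cov a(2) a(1)])
    show "simply_connected ?D" by (intro convex_imp_simply_connected convex_ball)
    show "locally path_connected ?D"
      by (intro convex_imp_locally_path_connected convex_ball)
    show "continuous_on ?D (\<phi> \<circ> p)" by (rule holomorphic_on_imp_continuous_on[OF hol'])
  qed (use im a in auto)
  have "g holomorphic_on ?D"
    by (rule covering_space_lift_is_holomorphic[OF cov open_ball hol hol' im g(2,1,4)])
  then show thesis using g by (intro that[of g]) auto
qed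

lemma fibre_nonempty: "z \<in> U \<Longrightarrow> fibre z \<noteq> {}"
  using preimage[of z] by (auto simp: fibre_def)

lemma bdd_below_fibre_dist: "bdd_below ((\<lambda>x. disc_dist (fst x) (snd x)) ` (fibre z \<times> fibre w))"
  by (rule bdd_belowI2[of _ 0]) (auto simp: fibre_def intro: disc_dist_nonneg)

lemma dist_U_le:
  assumes "a \<in> ball 0 1" "b \<in> ball 0 1"
  shows "dist_U (p a) (p b) \<le> disc_dist a b"
proof -
  have "(a, b) \<in> fibre (p a) \<times> fibre (p b)" using assms by (simp add: fibre_def)
  then show ?thesis
    unfolding dist_U_def by (rule cINF_lower2[OF bdd_below_fibre_dist]) simp
qed

lemma dist_U_near:
  assumes "z \<in> U" "w \<in> U" "0 < e"
  obtains a b where "a \<in> ball 0 1" "b \<in> ball 0 1" "p a = z" "p b = w" "disc_dist a b < dist_U z w + e"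
proof -
  have "fibre z \<times> fibre w \<noteq> {}" using assms fibre_nonempty by simp
  moreover have "(INF x\<in>fibre z \<times> fibre w. disc_dist (fst x) (snd x)) < dist_U z w + e"
    using assms by (simp add: dist_U_def)
  ultimately have "\<exists>x\<in>fibre z \<times> fibre w. disc_dist (fst x) (snd x) < dist_U z w + e"
    by (rule iffD1[OF cINF_less_iff[OF _ bdd_below_fibre_dist]])
  then obtain x where "x \<in> fibre z \<times> fibre w" "disc_dist (fst x) (snd x) < dist_U z w + e"
    by (rule bexE)
  then show thesis by (intro that[of "fst x" "snd x"]) (auto simp: fibre_def)
qed

text \<open>Lifting \<open>p\<close> through itself gives a deck transformation carrying the first point to \<open>a\<close>.\<close>

lemma dist_U_near_from:
  assumes a: "a \<in> ball 0 1" and w: "w \<in> U" and e: "0 < e"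
  obtains b where "b \<in> ball 0 1" "p b = w" "disc_dist a b < dist_U (p a) w + e"
proof -
  obtain a' b' where ab: "a' \<in> ball 0 1" "b' \<in> ball 0 1" "p a' = p a" "p b' = w"
      "disc_dist a' b' < dist_U (p a) w + e"
    using dist_U_near[OF p_in[OF a] w e] by metis
  obtain g where g: "g holomorphic_on ball 0 1" "g ` ball 0 1 \<subseteq> ball 0 1" "g a' = a"
      "\<And>z. z \<in> ball 0 1 \<Longrightarrow> p (g z) = p z"
    using holomorphic_lift[of "\<lambda>z. z" a' a] ab a by auto
  have "disc_dist a (g b') \<le> disc_dist a' b'"
    using disc_dist_contraction[OF g(1,2), of a' b'] ab g(3) by auto
  moreover have "g b' \<in> ball 0 1" using g(2) ab(2) by blast
  ultimately show thesis using ab g by (intro that[of "g b'"]) auto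
qed

lemma dist_U_nonneg: "\<lbrakk>z \<in> U; w \<in> U\<rbrakk> \<Longrightarrow> 0 \<le> dist_U z w"
  unfolding dist_U_def
  by (rule cINF_greatest) (auto simp: fibre_nonempty, auto simp: fibre_def intro: disc_dist_nonneg)

lemma dist_U_commute:
  assumes "z \<in> U" "w \<in> U"
  shows "dist_U z w = dist_U w z"
proof -
  have "dist_U w z \<le> dist_U z w" if "z \<in> U" "w \<in> U" for z w
    unfolding dist_U_def[of z w]
  proof (rule cINF_greatest)
    fix x assume "x \<in> fibre z \<times> fibre w"
    then show "dist_U w z \<le> disc_dist (fst x) (snd x)"
      using dist_U_le[of "snd x" "fst x"] disc_dist_commute[of "fst x" "snd x"] by (auto simp: fibre_def)
  qed (use that fibre_nonempty in simp)
  then show ?thesis using assms by (simp add: order_antisym)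
qed

lemma dist_U_triangle:
  assumes "x \<in> U" "y \<in> U" "z \<in> U"
  shows "dist_U x z \<le> dist_U x y + dist_U y z"
proof (rule field_le_epsilon)
  fix e :: real assume "0 < e"
  then have e: "0 < e / 2" by simp
  obtain a b where ab: "a \<in> ball 0 1" "b \<in> ball 0 1" "p a = x" "p b = y" "disc_dist a b < dist_U x y + e / 2"
    using dist_U_near[OF assms(1,2) e] by metis
  \<comment> \<open>The second almost optimal pair has to start at the same lift \<open>b\<close>,
    so that the triangle inequality of the disc applies.\<close>
  obtain c where c: "c \<in> ball 0 1" "p c = z" "disc_dist b c < dist_U y z + e / 2"
    using dist_U_near_from[OF ab(2) assms(3) e] ab by metis
  have "dist_U x z \<le> disc_dist a c" using dist_U_le[OF ab(1) c(1)] ab c by simp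
  also have "\<dots> \<le> disc_dist a b + disc_dist b c" using ab c by (intro disc_dist_triangle) auto
  finally show "dist_U x z \<le> dist_U x y + dist_U y z + e" using ab c by simp
qed

text \<open>A lift of \<open>\<phi>\<close> to a self-map of the disc contracts
  \<open>disc_dist\<close> by Schwarz-Pick, and it carries lifts of \<open>z\<close> and
  \<open>w\<close> to lifts of their images.\<close>

lemma dist_U_contraction:
  assumes \<phi>: "\<phi> holomorphic_on U" "\<phi> ` U \<subseteq> U" and "z \<in> U" "w \<in> U"
  shows "dist_U (\<phi> z) (\<phi> w) \<le> dist_U z w"
proof (rule field_le_epsilon)
  fix e :: real assume e: "0 < e"
  obtain a b where ab: "a \<in> ball 0 1" "b \<in> ball 0 1" "p a = z" "p b = w" "disc_dist a b < dist_U z w + e"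
    using dist_U_near[OF assms(3,4) e] by metis
  have "\<phi> z \<in> U" using \<phi>(2) assms by auto
  then obtain a' where "a' \<in> ball 0 1" "p a' = \<phi> (p a)" using preimage ab by metis
  then obtain g where g: "g holomorphic_on ball 0 1" "g ` ball 0 1 \<subseteq> ball 0 1"
      "\<And>z. z \<in> ball 0 1 \<Longrightarrow> p (g z) = \<phi> (p z)"
    using holomorphic_lift[OF \<phi> ab(1)] by metis
  have "dist_U (\<phi> z) (\<phi> w) \<le> disc_dist (g a) (g b)"
    using dist_U_le[of "g a" "g b"] g ab by (auto simp: image_subset_iff)
  also have "\<dots> \<le> disc_dist a b" using ab by (intro disc_dist_contraction g) auto
  finally show "dist_U (\<phi> z) (\<phi> w) \<le> dist_U z w + e" using ab by simp
qed

lemma proper_pseudometric_dist_U: "proper_pseudometric U dist_U"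
proof
  fix x and e :: real assume x: "x \<in> U" and e: "0 < e"
  obtain a where a: "a \<in> ball 0 1" "p a = x" using preimage[OF x] by blast
  obtain N where N: "open N" "a \<in> N" "N \<subseteq> ball 0 1" "\<And>b. b \<in> N \<Longrightarrow> disc_dist a b < e"
    using disc_dist_small_nhd[OF _ e, of a] a by auto
  \<comment> \<open>Coverings are open maps, so a small neighbourhood of a lift projects to one of
    \<open>x\<close>.\<close>
  have "openin (top_of_set U) (p ` N)"
    using N by (intro covering_space_open_map[OF cov]) (simp add: open_openin_trans)
  then have "open (p ` N)" using openU openin_open_trans by blast
  moreover have "dist_U x y < e" if "y \<in> p ` N" for y
  proof -
    obtain b where b: "b \<in> N" "y = p b" using \<open>y \<in> p ` N\<close> by blast
    have "dist_U (p a) (p b) \<le> disc_dist a b" using a b N(3) by (intro dist_U_le) auto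
    then show ?thesis using N(4)[OF b(1)] a b by simp
  qed
  ultimately show "\<exists>N. open N \<and> x \<in> N \<and> (\<forall>y\<in>N \<inter> U. dist_U x y < e)"
    using N(2) a(2) by (intro exI[of _ "p ` N"]) auto
next
  fix x M assume x: "x \<in> U"
  have 0: "p 0 \<in> U" by (rule p_in) simp
  \<comment> \<open>Points within \<open>M\<close> of \<open>x\<close> are within
    \<open>dist_U (p 0) x + M\<close> of \<open>p 0\<close>; the extra 1 allows for an infimum that
    is not attained.\<close>
  define R where "R = tanh (dist_U (p 0) x + M + 1)"
  have R: "cball 0 R \<subseteq> ball (0::complex) 1"
    using tanh_real_lt_1[of "dist_U (p 0) x + M + 1"] by (auto simp: R_def)
  show "\<exists>K. compact K \<and> K \<subseteq> U \<and> {y \<in> U. dist_U x y \<le> M} \<subseteq> K"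
  proof (intro exI conjI)
    show "compact (p ` cball 0 R)"
      using R hol by (intro compact_continuous_image) (auto intro: holomorphic_on_imp_continuous_on holomorphic_on_subset)
    show "p ` cball 0 R \<subseteq> U" using R p_in by blast
    show "{y \<in> U. dist_U x y \<le> M} \<subseteq> p ` cball 0 R"
    proof
      fix y assume "y \<in> {y \<in> U. dist_U x y \<le> M}"
      then have y: "y \<in> U" "dist_U x y \<le> M" by auto
      obtain b where b: "b \<in> ball 0 1" "p b = y" "disc_dist 0 b < dist_U (p 0) y + 1"
        using dist_U_near_from[of 0 y 1] y by auto
      have "disc_dist 0 b \<le> dist_U (p 0) x + M + 1"
        using b(3) dist_U_triangle[OF 0 x y(1)] y(2) by linarith
      then have "norm b \<le> R" using b(1) unfolding R_def by (intro disc_dist_le_imp_norm_le) auto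
      then show "y \<in> p ` cball 0 R" using b(2) by auto
    qed
  qed
qed (use dist_U_nonneg dist_U_commute dist_U_triangle in auto)

end

text \<open>The failure of strong runaway is exactly the hypothesis of infinitely many returns in
  \<open>frequent_return_orbits_bounded\<close>, applied to \<open>dist_U\<close>.\<close>

lemma not_strongly_runaway_orbit_compact:
  assumes "hyperbolic_domain U" "\<phi> holomorphic_on U" "\<phi> ` U \<subseteq> U" "\<not> strongly_runaway U \<phi>" "z \<in> U"
  obtains C where "compact C" "C \<subseteq> U" "\<And>n. (\<phi> ^^ n) z \<in> C"
proof -
  obtain p where p: "disc_covering p U"
    using assms(1) by (auto simp: hyperbolic_domain_def domain_def disc_covering_def)
  interpret disc_covering p U by (rule p)
  interpret proper_pseudometric U dist_U by (rule proper_pseudometric_dist_U)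
  interpret nonexpansive_map U dist_U \<phi>
    by unfold_locales (use assms dist_U_contraction in auto)
  obtain K where "compact K" "K \<subseteq> U" "\<And>n0. \<exists>n\<ge>n0. (\<phi> ^^ n) ` K \<inter> K \<noteq> {}"
    using assms(4) unfolding strongly_runaway_def by auto
  then show thesis using frequent_return_orbits_bounded assms(5) that by metis
qed

section \<open>Functionals on the space of holomorphic functions\<close>

lemma openin_weak: "\<lbrakk>L \<in> dual_H U; open V\<rbrakk> \<Longrightarrow> openin (weak_topology U) {f \<in> H U. L f \<in> V}"
  unfolding weak_topology_def
  by (intro topology_generated_by_Basis CollectI exI[of _ L] exI[of _ V]) simp

text \<open>The only form in which weak density is used: tests by a pair of functionals.\<close>

lemma weakly_dense_two_functionals:
  assumes "weak_topology U closure_of A = H U"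
    and "L \<in> dual_H U" "M \<in> dual_H U" "open V" "open W"
    and "g \<in> H U" "L g \<in> V" "M g \<in> W"
  obtains h where "h \<in> A" "L h \<in> V" "M h \<in> W"
proof -
  let ?T = "{f \<in> H U. L f \<in> V} \<inter> {f \<in> H U. M f \<in> W}"
  have "openin (weak_topology U) ?T" 
    by (rule openin_Int[OF openin_weak[OF assms(2,4)] openin_weak[OF assms(3,5)]])
  moreover have "g \<in> weak_topology U closure_of A" using assms(1,6) by simp
  moreover have "g \<in> ?T" using assms(6-8) by simp
  ultimately obtain h where "h \<in> A" "h \<in> ?T" unfolding in_closure_of by meson
  then show thesis using that[of h] by simp
qed

lemma compact_open_sup_nhd:
  assumes g: "g \<in> H U" and K: "compact K" "K \<subseteq> U" and e: "0 < e"
  obtains T where "openin (compact_open U) T" "g \<in> T"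
    "\<And>h z. \<lbrakk>h \<in> T; z \<in> K\<rbrakk> \<Longrightarrow> norm (h z - g z) < e"
proof -
  have cont: "continuous_on K g"
    using g K by (auto simp: H_def intro: holomorphic_on_imp_continuous_on holomorphic_on_subset)
  then have "compact (g ` K)" using K by (intro compact_continuous_image)
  then obtain F where F: "F \<subseteq> g ` K" "finite F" "g ` K \<subseteq> (\<Union>x\<in>F. ball x (e / 4))"
    by (rule compactE_image[of "g ` K" "g ` K" "\<lambda>x. ball x (e / 4)"]) (use e in auto)
  define K' where "K' x = K \<inter> g -` cball x (e / 4)" for x
  have K': "compact (K' x)" "K' x \<subseteq> U" for x
  proof -
    have "closedin (top_of_set K) (K' x)"
      unfolding K'_def using cont by (intro continuous_closedin_preimage) auto
    then show "compact (K' x)" using K(1) closedin_compact by blast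
  qed (use K in \<open>auto simp: K'_def\<close>)
  \<comment> \<open>The factor \<open>H U\<close> covers the case of empty \<open>F\<close>, which
    occurs when \<open>K\<close> is empty.\<close>
  define T where "T = H U \<inter> (\<Inter>x\<in>F. {h \<in> H U. h ` K' x \<subseteq> ball x (e / 2)})"
  have "openin (compact_open U) {h \<in> H U. h ` K' x \<subseteq> ball x (e / 2)}" for x
    unfolding compact_open_def
    by (intro topology_generated_by_Basis CollectI exI[of _ "K' x"] exI[of _ "ball x (e / 2)"]) (simp add: K')
  moreover have "openin (compact_open U) (H U)"
    using openin_topspace[of "compact_open U"] by (simp add: topspace_compact_open)
  ultimately have "openin (compact_open U) T"
    unfolding T_def using F(2) by (cases "F = {}") (simp_all add: openin_Int openin_INT2)
  moreover have "g ` K' x \<subseteq> ball x (e / 2)" for x using e by (auto simp: K'_def)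
  then have "g \<in> T" using g by (simp add: T_def)
  moreover have "norm (h z - g z) < e" if "h \<in> T" "z \<in> K" for h z
  proof -
    obtain x where x: "x \<in> F" "dist x (g z) < e / 4" using F(3) \<open>z \<in> K\<close> by auto
    then have "z \<in> K' x" using \<open>z \<in> K\<close> by (auto simp: K'_def)
    moreover have "h ` K' x \<subseteq> ball x (e / 2)" using \<open>h \<in> T\<close> x(1) by (simp add: T_def)
    ultimately have "h z \<in> ball x (e / 2)" by blast
    then have "dist x (h z) < e / 2" by simp
    then have "dist (h z) (g z) < e" using x(2) e dist_triangle[of "h z" "g z" x]
      by (simp add: dist_commute)
    then show ?thesis by (simp add: dist_norm)
  qed
  ultimately show thesis by (rule that)
qed

lemma H_add: "\<lbrakk>f \<in> H U; g \<in> H U\<rbrakk> \<Longrightarrow> (\<lambda>z. f z + g z) \<in> H U"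
  by (auto simp: H_def intro: holomorphic_intros)

lemma H_scale: "f \<in> H U \<Longrightarrow> (\<lambda>z. c * f z) \<in> H U"
  by (auto simp: H_def intro: holomorphic_intros)

text \<open>By linearity it suffices that \<open>L\<close> is small on functions that are small on
  \<open>K\<close>. Quantifying over all bounds \<open>B\<close> avoids handling the supremum
  itself.\<close>

lemma sup_bounded_functional_in_dual:
  assumes lin: "linear_functional_on_H U L" and K: "compact K" "K \<subseteq> U"
    and bound: "\<And>g B. \<lbrakk>g \<in> H U; \<And>z. z \<in> K \<Longrightarrow> norm (g z) \<le> B\<rbrakk> \<Longrightarrow> norm (L g) \<le> C * B"
  shows "L \<in> dual_H U"
proof -
  have "continuous_map (compact_open U) euclidean L"
    unfolding continuous_map_eq_topcontinuous_at topcontinuous_at_def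
  proof (safe, simp_all add: topspace_compact_open)
    fix g V assume g: "g \<in> H U" and V: "open V" "L g \<in> V"
    obtain e where e: "0 < e" "ball (L g) e \<subseteq> V" using V open_contains_ball by blast
    \<comment> \<open>The denominator is positive whatever the sign of \<open>C\<close>.\<close>
    define \<delta> where "\<delta> = e / (\<bar>C\<bar> + 1)"
    have \<delta>: "0 < \<delta>" "\<bar>C\<bar> * \<delta> < e" using e by (auto simp: \<delta>_def field_simps)
    obtain T where T: "openin (compact_open U) T" "g \<in> T"
        "\<And>h z. \<lbrakk>h \<in> T; z \<in> K\<rbrakk> \<Longrightarrow> norm (h z - g z) < \<delta>"
      using compact_open_sup_nhd[OF g K \<delta>(1)] by blast
    have "L h \<in> V" if h: "h \<in> T" for h
    proof -
      have hH: "h \<in> H U" using openin_subset[OF T(1)] h topspace_compact_open by blast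
      let ?k = "\<lambda>z. h z + - 1 * g z"
      have k: "?k \<in> H U" by (intro H_add H_scale hH g)
      have "L ?k = L h + L (\<lambda>z. - 1 * g z)"
        by (rule lin[unfolded linear_functional_on_H_def, THEN conjunct1, rule_format, OF hH H_scale[OF g]])
      also have "L (\<lambda>z. - 1 * g z) = - 1 * L g"
        by (rule lin[unfolded linear_functional_on_H_def, THEN conjunct2, rule_format, OF g])
      finally have "L ?k = L h - L g" by simp
      moreover have "norm (L ?k) \<le> C * \<delta>"
        using T(3)[OF h] by (intro bound k) (simp add: less_imp_le)
      ultimately have "norm (L h - L g) \<le> C * \<delta>" by simp
      also have "\<dots> \<le> \<bar>C\<bar> * \<delta>" using \<delta> by (intro mult_right_mono) auto
      finally have "norm (L h - L g) < e" using \<delta> by linarith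
      then have "L h \<in> ball (L g) e" by (simp add: dist_norm norm_minus_commute)
      then show ?thesis using e by blast
    qed
    then show "\<exists>T. openin (compact_open U) T \<and> g \<in> T \<and> (\<forall>h\<in>T. L h \<in> V)" using T by blast
  qed
  then show ?thesis using lin by (simp add: dual_H_def)
qed

text \<open>All explicit test functions below are of this kind; the value 0 off \<open>U\<close> is
  what the encoding of \<open>H U\<close> demands.\<close>

definition affine_on :: "complex set \<Rightarrow> complex \<Rightarrow> complex \<Rightarrow> complex \<Rightarrow> complex" where
  "affine_on U \<alpha> \<beta> = (\<lambda>z. if z \<in> U then \<alpha> * z + \<beta> else 0)"

lemma affine_in_H: "affine_on U \<alpha> \<beta> \<in> H U"
proof -
  have "affine_on U \<alpha> \<beta> holomorphic_on U"
    by (rule holomorphic_transform[of "\<lambda>z. \<alpha> * z + \<beta>"]) (auto simp: affine_on_def intro!: holomorphic_intros)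
  then show ?thesis by (simp add: H_def affine_on_def)
qed

lemma evaluations_in_dual:
  assumes "a \<in> U" "b \<in> U"
  shows "(\<lambda>g. u * g a + v * g b) \<in> dual_H U"
proof (rule sup_bounded_functional_in_dual)
  show "norm (u * g a + v * g b) \<le> (norm u + norm v) * B" if "\<And>z. z \<in> {a, b} \<Longrightarrow> norm (g z) \<le> B" for g B
  proof -
    have "norm (u * g a + v * g b) \<le> norm u * norm (g a) + norm v * norm (g b)"
      using norm_triangle_ineq[of "u * g a" "v * g b"] by (simp add: norm_mult)
    also have "\<dots> \<le> norm u * B + norm v * B" using that by (intro add_mono mult_left_mono) auto
    finally show ?thesis by (simp add: distrib_right)
  qed
qed (use assms in \<open>auto simp: linear_functional_on_H_def algebra_simps\<close>)

lemma comp_op_iterate: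
  assumes "\<phi> ` U \<subseteq> U" "z \<in> U"
  shows "(comp_op U \<phi> ^^ n) f z = f ((\<phi> ^^ n) z)"
  using assms(2)
proof (induction n arbitrary: z)
  case (Suc n)
  then have "\<phi> z \<in> U" using assms(1) by auto
  then show ?case using Suc by (simp add: comp_op_def funpow_swap1)
qed simp

lemma comp_op_iterate_in_H:
  assumes "\<phi> holomorphic_on U" "\<phi> ` U \<subseteq> U" "f \<in> H U"
  shows "(comp_op U \<phi> ^^ n) f \<in> H U"
  by (induction n) (simp_all add: comp_op_in_H assms)

section \<open>Consequences of weak supercyclicity: injectivity and the exclusion of compact
  orbits\<close>

text \<open>\<open>L\<close> kills the multiples with \<open>n > 0\<close> and \<open>M\<close>
  those with \<open>n = 0\<close>, yet an affine function is killed by neither.\<close>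

lemma weakly_supercyclic_imp_inj:
  assumes \<phi>: "\<phi> ` U \<subseteq> U" and ws: "weakly_supercyclic U (comp_op U \<phi>)"
  shows "inj_on \<phi> U"
proof (rule inj_onI, rule ccontr)
  fix a b assume ab: "a \<in> U" "b \<in> U" "\<phi> a = \<phi> b" "a \<noteq> b"
  obtain f where f: "f \<in> H U"
    and dense: "weak_topology U closure_of {(\<lambda>z. c * (comp_op U \<phi> ^^ n) f z) | c n. True} = H U"
    using ws unfolding weakly_supercyclic_def by blast
  let ?A = "{(\<lambda>z. c * (comp_op U \<phi> ^^ n) f z) | c n. True}"
  define L where "L g = 1 * g a + (-1) * g b" for g :: "complex \<Rightarrow> complex"
  have LD: "L \<in> dual_H U" unfolding L_def by (rule evaluations_in_dual[OF ab(1,2)])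
  have LA: "h = (\<lambda>z. c * f z)" if h: "h = (\<lambda>z. c * (comp_op U \<phi> ^^ n) f z)" "L h \<noteq> 0" for h c n
  proof (cases n)
    case (Suc m)
    have "(comp_op U \<phi> ^^ n) f x = f ((\<phi> ^^ m) (\<phi> x))" if "x \<in> U" for x
      using comp_op_iterate[OF \<phi> that, of n f] by (simp only: Suc funpow_Suc_right o_apply)
    then have "L h = 0" using ab by (simp add: h(1) L_def)
    then show ?thesis using h by simp
  qed (use h in simp)
  define u v where "u = L f" and "v = f a"
  \<comment> \<open>\<open>M g\<close> equals \<open>L f * g a - f a * L g\<close>, a determinant
    that vanishes on the line spanned by \<open>f\<close>.\<close>
  define M where "M g = (u - v) * g a + v * g b" for g :: "complex \<Rightarrow> complex"
  have MD: "M \<in> dual_H U" unfolding M_def by (rule evaluations_in_dual[OF ab(1,2)])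
  have MA: "M (\<lambda>z. c * f z) = 0" for c by (simp add: M_def L_def u_def v_def algebra_simps)
  have N: "open (- {0::complex})" by auto
  \<comment> \<open>Otherwise \<open>L\<close> would vanish on all the multiples. A single
    functional suffices here, so \<open>L\<close> is passed twice.\<close>
  have "u \<noteq> 0"
  proof
    assume "u = 0"
    obtain h where h: "h \<in> ?A" "L h \<in> - {0}"
    proof (rule weakly_dense_two_functionals[OF dense LD LD N N affine_in_H])
      show "L (affine_on U 1 0) \<in> - {0}" using ab by (simp add: L_def affine_on_def)
      then show "L (affine_on U 1 0) \<in> - {0}" .
    qed blast
    then obtain c where "h = (\<lambda>z. c * f z)" using LA by blast
    then have "L h = c * u" by (simp add: L_def u_def algebra_simps)
    then show False using h \<open>u = 0\<close> by simp
  qed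
  \<comment> \<open>The slope \<open>1 / (a - b)\<close> makes \<open>L ?g = 1\<close>, and
    \<open>\<beta>\<close> makes \<open>?g a = 1 + v / u\<close>; together these give
    \<open>M ?g = u\<close>.\<close>
  define \<beta> where "\<beta> = 1 - a / (a - b) + v / u"
  let ?g = "affine_on U (1 / (a - b)) \<beta>"
  have g: "?g a = 1 + v / u" "?g a - ?g b = 1"
    using ab by (auto simp: affine_on_def \<beta>_def simp flip: diff_divide_distrib)
  obtain h where h: "h \<in> ?A" "L h \<in> - {0}" "M h \<in> - {0}"
  proof (rule weakly_dense_two_functionals[OF dense LD MD N N affine_in_H])
    show "L ?g \<in> - {0}" using g(2) by (simp add: L_def)
    have "M ?g = u * ?g a - v * (?g a - ?g b)" by (simp add: M_def algebra_simps)
    also have "\<dots> = u * (1 + v / u) - v * 1" unfolding g(2) unfolding g(1) ..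
    also have "\<dots> = u" using \<open>u \<noteq> 0\<close> by (simp add: field_simps)
    finally show "M ?g \<in> - {0}" using \<open>u \<noteq> 0\<close> by simp
  qed
  then obtain c where "h = (\<lambda>z. c * f z)" using LA by blast
  then show False using MA h(3) by simp
qed

text \<open>The functional is a cluster point, in the Tychonoff product, of the averages over initial
  segments of the orbit.\<close>

lemma invariant_mean_on_orbit:
  assumes \<phi>: "\<phi> holomorphic_on U" "\<phi> ` U \<subseteq> U" and z: "z \<in> U"
    and K: "compact K" "K \<subseteq> U" "\<And>n. (\<phi> ^^ n) z \<in> K"
  obtains L where "L \<in> dual_H U" "\<And>g. g \<in> H U \<Longrightarrow> L (comp_op U \<phi> g) = L g"
    "L (affine_on U 0 1) = 1"
proof -
  \<comment> \<open>Averaging over \<open>Suc N\<close> points avoids division by 0. The value 0 off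
    \<open>H U\<close> keeps each \<open>A N\<close> inside the compact product
    \<open>PiE UNIV S\<close>.\<close>
  define A where "A N g = (if g \<in> H U then (\<Sum>n<Suc N. g ((\<phi> ^^ n) z)) / of_nat (Suc N) else 0)"
    for N and g :: "complex \<Rightarrow> complex"
  have A_bound: "norm (A N g) \<le> B" if "g \<in> H U" "\<And>z. z \<in> K \<Longrightarrow> norm (g z) \<le> B" for N g B
  proof -
    have "norm (\<Sum>n<Suc N. g ((\<phi> ^^ n) z)) \<le> (\<Sum>n<Suc N. B)"
      using K(3) that(2) by (intro sum_norm_le) auto
    then show ?thesis using that(1) by (simp add: A_def norm_divide field_simps del: of_nat_Suc sum.lessThan_Suc)
  qed
  have "\<exists>B\<ge>0. \<forall>z\<in>K. norm (g z) \<le> B" if "g \<in> H U" for g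
  proof -
    have "continuous_on K g"
      using that K by (auto simp: H_def intro: holomorphic_on_imp_continuous_on holomorphic_on_subset)
    then have "bounded (g ` K)" using K by (intro compact_imp_bounded compact_continuous_image)
    then show ?thesis by (metis bounded_pos image_eqI less_imp_le)
  qed
  then obtain b where b: "\<And>g. g \<in> H U \<Longrightarrow> 0 \<le> b g \<and> (\<forall>z\<in>K. norm (g z) \<le> b g)" by metis
  define S where "S g = (if g \<in> H U then cball (0::complex) (b g) else {0})" for g
  have "compactin (product_topology (\<lambda>_. euclidean) UNIV) (PiE UNIV S)"
    unfolding compactin_PiE by (simp add: S_def)
  then have "compact (PiE UNIV S)" by (simp add: euclidean_product_topology)
  moreover have "A N g \<in> S g" for N g
    using A_bound[of g "b g" N] b[of g] by (cases "g \<in> H U") (simp_all add: S_def A_def)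
  then have "\<forall>\<^sub>F M in filtermap A sequentially. M \<in> PiE UNIV S"
    by (simp add: eventually_filtermap PiE_UNIV_domain)
  moreover have "filtermap A sequentially \<noteq> bot" by (simp add: filtermap_bot_iff)
  ultimately have "\<exists>L\<in>PiE UNIV S. inf (nhds L) (filtermap A sequentially) \<noteq> bot"
    unfolding compact_filter by simp
  then obtain L where L: "inf (nhds L) (filtermap A sequentially) \<noteq> bot"
    by (rule bexE)
  \<comment> \<open>Along this proper filter the averages converge to \<open>L\<close>
    coordinatewise, so whatever holds for every \<open>A N\<close> passes to the limit.\<close>
  define F where "F = inf (nhds L) (filtermap A sequentially)"
  have F: "F \<noteq> bot" "F \<le> filtermap A sequentially" "F \<le> nhds L" using L by (auto simp: F_def)
  have lim: "((\<lambda>M. M g) \<longlongrightarrow> L g) F" for g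
  proof -
    have "open {M :: (complex \<Rightarrow> complex) \<Rightarrow> complex. M g \<in> V}" if "open V" for V
      using open_vimage[OF that continuous_on_product_coordinates[of g]] by (simp add: vimage_def)
    then have "((\<lambda>M. M g) \<longlongrightarrow> L g) (nhds L)"
      by (intro topological_tendstoI eventually_nhds[THEN iffD2])
         (metis mem_Collect_eq)
    then show ?thesis by (rule tendsto_mono[OF F(3)])
  qed
  have transfer: "eventually P F" if "\<And>N. P (A N)" for P
    using filter_leD[OF F(2), of P] that by (simp add: eventually_filtermap)
  have add: "L (\<lambda>z. f z + g z) = L f + L g" if "f \<in> H U" "g \<in> H U" for f g
  proof (rule tendsto_unique[OF F(1) lim])
    have "\<forall>\<^sub>F M in F. M f + M g = M (\<lambda>z. f z + g z)"
      by (rule transfer) (use that in \<open>simp add: A_def H_add sum.distrib add_divide_distrib\<close>)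
    then show "((\<lambda>M. M (\<lambda>z. f z + g z)) \<longlongrightarrow> L f + L g) F"
      by (rule Lim_transform_eventually[OF tendsto_add[OF lim lim]])
  qed
  have scale: "L (\<lambda>z. c * f z) = c * L f" if "f \<in> H U" for c f
  proof (rule tendsto_unique[OF F(1) lim])
    have "\<forall>\<^sub>F M in F. c * M f = M (\<lambda>z. c * f z)"
      by (rule transfer) (use that in \<open>simp add: A_def H_scale sum_distrib_left distrib_left\<close>)
    then show "((\<lambda>M. M (\<lambda>z. c * f z)) \<longlongrightarrow> c * L f) F"
      by (rule Lim_transform_eventually[OF tendsto_mult_left[OF lim]])
  qed
  have "L \<in> dual_H U"
  proof (rule sup_bounded_functional_in_dual[OF _ K(1,2), where C = 1])
    show "linear_functional_on_H U L" using add scale by (simp add: linear_functional_on_H_def)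
    show "norm (L g) \<le> 1 * B" if "g \<in> H U" "\<And>z. z \<in> K \<Longrightarrow> norm (g z) \<le> B" for g B
      unfolding mult_1
      by (rule Lim_norm_ubound[OF F(1) lim]) (rule transfer, rule A_bound[OF that])
  qed
  moreover have "L (comp_op U \<phi> g) = L g" if g: "g \<in> H U" for g
  proof -
    have orbit: "(\<phi> ^^ n) z \<in> U" for n using K by blast
    \<comment> \<open>Composition with \<open>\<phi>\<close> shifts the sum by one step, so only the
      two end terms survive.\<close>
    have diff: "A N (comp_op U \<phi> g) - A N g = (g ((\<phi> ^^ Suc N) z) - g z) / of_nat (Suc N)" for N
    proof -
      have "(\<Sum>n<Suc N. comp_op U \<phi> g ((\<phi> ^^ n) z)) = (\<Sum>n<Suc N. g ((\<phi> ^^ Suc n) z))"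
        using orbit by (simp add: comp_op_def)
      moreover have "(\<Sum>n<Suc N. g ((\<phi> ^^ Suc n) z)) - (\<Sum>n<Suc N. g ((\<phi> ^^ n) z))
          = g ((\<phi> ^^ Suc N) z) - g z"
        using sum_lessThan_telescope[of "\<lambda>n. g ((\<phi> ^^ n) z)" "Suc N"] by (simp add: sum_subtractf)
      ultimately show ?thesis
        using g comp_op_in_H[OF \<phi> g] by (simp only: A_def if_True flip: diff_divide_distrib)
    qed
    have small: "norm (A N (comp_op U \<phi> g) - A N g) \<le> 2 * b g / of_nat (Suc N)" for N
    proof -
      have "norm (g ((\<phi> ^^ Suc N) z) - g z) \<le> b g + b g"
        using b[OF g] K(3)[of "Suc N"] K(3)[of 0] by (intro norm_triangle_le_diff add_mono) auto
      then show ?thesis by (simp add: diff norm_divide divide_right_mono del: of_nat_Suc funpow.simps)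
    qed
    have "(\<lambda>N. A N (comp_op U \<phi> g) - A N g) \<longlonglongrightarrow> 0"
      by (rule Lim_null_comparison[OF always_eventually[OF allI[OF small]] LIMSEQ_Suc[OF lim_const_over_n]])
    then have "((\<lambda>M. M (comp_op U \<phi> g) - M g) \<longlongrightarrow> 0) (filtermap A sequentially)"
      by (simp add: filterlim_filtermap)
    then have "((\<lambda>M. M (comp_op U \<phi> g) - M g) \<longlongrightarrow> 0) F" using F(2) tendsto_mono by blast
    then have "L (comp_op U \<phi> g) - L g = 0"
      using tendsto_unique[OF F(1) tendsto_diff[OF lim lim]] by blast
    then show ?thesis by simp
  qed
  moreover have "L (affine_on U 0 1) = 1"
  proof (rule tendsto_unique[OF F(1) lim tendsto_eventually], rule transfer)
    fix N
    have "affine_on U 0 1 ((\<phi> ^^ n) z) = 1" for n using K by (auto simp: affine_on_def)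
    then show "A N (affine_on U 0 1) = 1" by (simp add: A_def affine_in_H del: of_nat_Suc sum.lessThan_Suc)
  qed
  ultimately show thesis by (rule that)
qed

text \<open>A multiple \<open>h\<close> with \<open>L h\<close> in the unit disc has
  \<open>norm c\<close> below \<open>1 / norm (L f)\<close>, hence \<open>norm (h w)\<close> at most
  \<open>B / norm (L f)\<close>. An affine function killed by \<open>L\<close> but large at
  \<open>w\<close> contradicts density.\<close>

lemma weakly_supercyclic_no_compact_orbits:
  assumes \<phi>: "\<phi> holomorphic_on U" "\<phi> ` U \<subseteq> U" and ws: "weakly_supercyclic U (comp_op U \<phi>)"
    and U: "open U" "U \<noteq> {}"
    and orbits: "\<And>z. z \<in> U \<Longrightarrow> \<exists>K. compact K \<and> K \<subseteq> U \<and> (\<forall>n. (\<phi> ^^ n) z \<in> K)"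
  shows False
proof -
  obtain f where f: "f \<in> H U"
    and dense: "weak_topology U closure_of {(\<lambda>z. c * (comp_op U \<phi> ^^ n) f z) | c n. True} = H U"
    using ws unfolding weakly_supercyclic_def by blast
  let ?A = "{(\<lambda>z. c * (comp_op U \<phi> ^^ n) f z) | c n. True}"
  obtain z where z: "z \<in> U" using U by blast
  obtain L where L: "L \<in> dual_H U" "\<And>g. g \<in> H U \<Longrightarrow> L (comp_op U \<phi> g) = L g"
      "L (affine_on U 0 1) = 1"
    using invariant_mean_on_orbit[OF \<phi> z] orbits[OF z] by metis
  have lin: "L (\<lambda>z. f z + g z) = L f + L g" "L (\<lambda>z. c * f z) = c * L f"
    if "f \<in> H U" "g \<in> H U" for f g c
    using L(1) that by (auto simp: dual_H_def linear_functional_on_H_def)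
  have "infinite U" using U finite_imp_not_open by blast
  \<comment> \<open>The mean of the identity function is a single number, so some \<open>w\<close>
    in the infinite set \<open>U\<close> differs from it.\<close>
  then obtain w where w: "w \<in> U" "w \<noteq> L (affine_on U 1 0)"
    by (metis finite.simps finite_subset insertCI subsetI)
  obtain K where K: "compact K" "K \<subseteq> U" "\<And>n. (\<phi> ^^ n) w \<in> K" using orbits[OF w(1)] by blast
  have "continuous_on K f"
    using f K by (auto simp: H_def intro: holomorphic_on_imp_continuous_on holomorphic_on_subset)
  then have "bounded (f ` K)" using K by (intro compact_imp_bounded compact_continuous_image)
  then obtain B where B: "\<And>n. norm (f ((\<phi> ^^ n) w)) \<le> B" using K(3) unfolding bounded_iff by blast
  define E where "E g = 1 * g w + 0 * g w" for g :: "complex \<Rightarrow> complex"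
  have E: "E \<in> dual_H U" unfolding E_def by (rule evaluations_in_dual[OF w(1) w(1)])
  have L_iter: "L ((comp_op U \<phi> ^^ n) f) = L f" for n
    by (induction n) (auto simp: L(2) comp_op_iterate_in_H[OF \<phi> f])
  have LA: "L (\<lambda>z. c * (comp_op U \<phi> ^^ n) f z) = c * L f" for c n
    using lin(2)[OF comp_op_iterate_in_H[OF \<phi> f] f] by (simp add: L_iter)
  have N: "open (- {0::complex})" by auto
  \<comment> \<open>Otherwise \<open>L\<close> would vanish on all the multiples, although it is 1
    on the constant 1.\<close>
  have "L f \<noteq> 0"
  proof -
    obtain h where "h \<in> ?A" "L h \<in> - {0}"
      by (rule weakly_dense_two_functionals[OF dense L(1) L(1) N N affine_in_H[of U 0 1]]) (use L(3) in auto)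
    then show ?thesis using LA by auto
  qed
  \<comment> \<open>The test function is \<open>z - L (affine_on U 1 0)\<close>, which
    \<open>L\<close> kills, scaled so that its value at \<open>w\<close> exceeds the bound by
    1.\<close>
  define t where "t = (of_real (B / norm (L f) + 1) :: complex) / (w - L (affine_on U 1 0))"
  define g where "g = affine_on U t (- t * L (affine_on U 1 0))"
  have "g = (\<lambda>z. t * affine_on U 1 0 z + - t * L (affine_on U 1 0) * affine_on U 0 1 z)"
    by (auto simp: g_def affine_on_def)
  then have "L g = 0"
    by (simp only: lin[OF affine_in_H affine_in_H] lin(1)[OF H_scale[OF affine_in_H] H_scale[OF affine_in_H]] L(3))
       simp
  have "0 \<le> B" using B[of 0] norm_ge_zero order_trans by blast
  have "E g = t * (w - L (affine_on U 1 0))"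
    using w(1) by (simp add: E_def g_def affine_on_def algebra_simps)
  then have Eg: "E g = of_real (B / norm (L f) + 1)" using w(2) by (simp add: t_def)
  obtain h where h: "h \<in> ?A" "L h \<in> ball 0 1" "E h \<in> - cball 0 (B / norm (L f))"
  proof (rule weakly_dense_two_functionals[OF dense L(1) E open_ball])
    show "g \<in> H U" unfolding g_def by (rule affine_in_H)
    show "L g \<in> ball 0 1" using \<open>L g = 0\<close> by simp
    have "norm (E g) = B / norm (L f) + 1"
      unfolding Eg norm_of_real using \<open>0 \<le> B\<close> by (simp add: add_nonneg_nonneg)
    then show "E g \<in> - cball 0 (B / norm (L f))" by simp
  qed auto
  then obtain c n where c: "h = (\<lambda>z. c * (comp_op U \<phi> ^^ n) f z)" by blast
  have "norm c * norm (L f) < 1" using h(2) by (simp add: c LA norm_mult)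
  then have "norm c \<le> 1 / norm (L f)" using \<open>L f \<noteq> 0\<close> by (simp add: field_simps)
  moreover have "norm (E h) \<le> norm c * B"
    using B[of n] by (simp add: c E_def comp_op_iterate[OF \<phi>(2) w(1)] norm_mult mult_left_mono)
  ultimately have "norm (E h) \<le> B / norm (L f)"
    using mult_right_mono[of "norm c" "1 / norm (L f)" B] \<open>0 \<le> B\<close> by simp
  then show False using h(3) by simp
qed

theorem corollary14:
  fixes U :: "complex set" and \<phi> :: "complex \<Rightarrow> complex"
  assumes "hyperbolic_domain U"
    and "\<phi> holomorphic_on U" and "\<phi> ` U \<subseteq> U"
    and "weakly_supercyclic U (comp_op U \<phi>)"
  shows "inj_on \<phi> U \<and> strongly_runaway U \<phi>"
proof
  show "inj_on \<phi> U" using assms(3,4) by (rule weakly_supercyclic_imp_inj)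
  have U: "open U" "U \<noteq> {}" using assms(1) by (auto simp: hyperbolic_domain_def domain_def)
  show "strongly_runaway U \<phi>"
  proof (rule ccontr)
    assume "\<not> strongly_runaway U \<phi>"
    then have "\<exists>K. compact K \<and> K \<subseteq> U \<and> (\<forall>n. (\<phi> ^^ n) z \<in> K)" if "z \<in> U" for z
      using not_strongly_runaway_orbit_compact[OF assms(1-3) _ that] by metis
    then show False using weakly_supercyclic_no_compact_orbits[OF assms(2-4) U] by blast
  qed
qed

end
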